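(* Let $\mathcal{X}\subseteq\mathbb{R}^n\times\mathbb{R}^{m\times n}\times\mathbb{R}^m$ be a domain of LP problems. Suppose $\mathcal{X}$ is weakly solution-wise bounded. Then the optimal value function $V$ is continuous on $\mathcal{X}$.
   Context: Let $m,n$ be positive integers. An $m\times n$ LP problem is a triple $\xi=(p(\xi),A(\xi),b(\xi))\in\mathbb{R}^n\times\mathbb{R}^{m\times n}\times\mathbb{R}^m$, standing for: maximize $p(\xi)^Tx$ subject to $A(\xi)x=b(\xi)$, $x\ge 0$ (coordinatewise). Its feasible set is $X(\xi)=\{x\in\mathbb{R}^n_+ : A(\xi)x=b(\xi)\}$ and its set of optimal solutions is $S(\xi)=\{x\in X(\xi): p(\xi)^Tx\ge p(\xi)^Tx' \text{ for all } x'\in X(\xi)\}$. A domain is a non-empty subset $\mathcal{X}$ of $\mathbb{R}^n\times\mathbb{R}^{m\times n}\times\mathbb{R}^m$ such that $S(\xi)\neq\emptyset$ for every $\xi\in\mathcal{X}$. The optimal value function $V:\mathcal{X}\to\mathbb{R}$ is $V(\xi)=p(\xi)^Tx$ for any $x\in S(\xi)$. Convergence of LP problems means convergence of each component $p$, $A$, $b$ in Euclidean norm; continuity of $V$ is with respect to this convergence within $\mathcal{X}$. $\mathcal{X}$ is weakly solution-wise bounded if there is a non-empty bounded subset $\Gamma$ of $\mathbb{R}^n\times\mathbb{R}^m$ such that for all $\xi\in\mathcal{X}$, $$\Gamma\cap\{(x,y)\in\mathbb{R}^n\times\mathbb{R}^m : x\in X(\xi),\ y^TA(\xi)\ge p(\xi)^T,\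 (y^TA(\xi)-p(\xi)^T)x=0\}\neq\emptyset.$$ *)

theory Defs
  imports "HOL-Analysis.Analysis"
begin

text \<open>
  An \<open>m \<times> n\<close> LP problem is a triple \<open>(p, A, b)\<close>; the positive integers \<open>m\<close>, \<open>n\<close> are the
  cardinalities of the finite index types \<open>'m\<close>, \<open>'n\<close>. The metric that the product type carries
  is the one of componentwise convergence in the Euclidean norm (Frobenius norm for \<open>A\<close>).
  The order on \<open>real ^ 'n\<close> is coordinatewise.
\<close>

type_synonym ('m, 'n) lp = "(real ^ 'n) \<times> (real ^ 'n ^ 'm) \<times> (real ^ 'm)"

definition lp_p :: "('m::finite, 'n::finite) lp \<Rightarrow> real ^ 'n" where
  "lp_p \<xi> = fst \<xi>"

definition lp_A :: "('m::finite, 'n::finite) lp \<Rightarrow> real ^ 'n ^ 'm" where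
  "lp_A \<xi> = fst (snd \<xi>)"

definition lp_b :: "('m::finite, 'n::finite) lp \<Rightarrow> real ^ 'm" where
  "lp_b \<xi> = snd (snd \<xi>)"

definition feasible_set :: "('m::finite, 'n::finite) lp \<Rightarrow> (real ^ 'n) set" where
  "feasible_set \<xi> = {x. 0 \<le> x \<and> lp_A \<xi> *v x = lp_b \<xi>}"

definition solution_set :: "('m::finite, 'n::finite) lp \<Rightarrow> (real ^ 'n) set" where
  "solution_set \<xi> =
    {x \<in> feasible_set \<xi>. \<forall>x' \<in> feasible_set \<xi>. lp_p \<xi> \<bullet> x' \<le> lp_p \<xi> \<bullet> x}"

definition lp_domain :: "('m::finite, 'n::finite) lp set \<Rightarrow> bool" where
  "lp_domain \<X> \<longleftrightarrow> \<X> \<noteq> {} \<and> (\<forall>\<xi> \<in> \<X>. solution_set \<xi> \<noteq> {})"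

text \<open>Meaningful only for LP problems with a solution; the choice of the solution is then immaterial.\<close>

definition optimal_value :: "('m::finite, 'n::finite) lp \<Rightarrow> real" where
  "optimal_value \<xi> = lp_p \<xi> \<bullet> (SOME x. x \<in> solution_set \<xi>)"

lemma optimal_value_eq:
  assumes "x \<in> solution_set \<xi>"
  shows "optimal_value \<xi> = lp_p \<xi> \<bullet> x"
proof -
  have "(SOME x. x \<in> solution_set \<xi>) \<in> solution_set \<xi>"
    using assms by (rule someI)
  with assms show ?thesis
    unfolding optimal_value_def solution_set_def by (auto intro: antisym)
qed

definition weakly_solution_wise_bounded :: "('m::finite, 'n::finite) lp set \<Rightarrow> bool" where
  "weakly_solution_wise_bounded \<X> \<longleftrightarrow>
    (\<exists>\<Gamma> :: ((real ^ 'n) \<times> (real ^ 'm)) set. \<Gamma> \<noteq> {} \<and> bounded \<Gamma> \<and>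
      (\<forall>\<xi> \<in> \<X>. \<Gamma> \<inter> {(x, y). x \<in> feasible_set \<xi> \<and> y v* lp_A \<xi> \<ge> lp_p \<xi> \<and>
                         (y v* lp_A \<xi> - lp_p \<xi>) \<bullet> x = 0} \<noteq> {}))"

end

theory Submission
  imports Defs
begin

text \<open>
  Let \<open>(x, y)\<close> and \<open>(x', y')\<close> be complementary primal-dual pairs of \<open>\<xi>\<close> and \<open>\<xi>'\<close>, taken from the
  bounded set. Weak duality, applied across the two problems to \<open>x'\<close> and \<open>y\<close>, gives
  \<open>V \<xi>' - V \<xi> \<le> y (b' - b) + y (A - A') x' + (p' - p) x'\<close>. With both pairs bounded in norm by \<open>B\<close>,
  the optimal value is therefore Lipschitz with constant \<open>2 B + B\<^sup>2\<close>.
\<close>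

text \<open>Cauchy-Schwarz on each row; the norm of \<open>A\<close> as a vector of rows is the
  Frobenius norm.\<close>

lemma norm_matrix_vector_mult_le:
  fixes A :: "real ^ 'n ^ 'm"
  shows "norm (A *v x) \<le> norm A * norm x"
proof -
  have "norm (A *v x) \<le> L2_set (\<lambda>i. norm (A $ i) * norm x) UNIV"
    unfolding norm_vec_def[of "A *v x"]
    by (rule L2_set_mono) (simp_all add: matrix_vector_mul_component Cauchy_Schwarz_ineq2)
  also have "\<dots> = norm A * norm x"
    by (simp add: norm_vec_def[of A] L2_set_left_distrib)
  finally show ?thesis .
qed

lemma inner_mono_nonneg:
  fixes u v x :: "real ^ 'n"
  assumes "u \<le> v" "0 \<le> x"
  shows "u \<bullet> x \<le> v \<bullet> x"
  using assms unfolding inner_vec_def less_eq_vec_def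
  by (auto intro!: sum_mono mult_right_mono)

text \<open>Primal feasibility, dual feasibility and complementary slackness: the optimality
  conditions of linear programming.\<close>

definition complementary_pairs ::
    "('m::finite, 'n::finite) lp \<Rightarrow> ((real ^ 'n) \<times> (real ^ 'm)) set" where
  "complementary_pairs \<xi> = {(x, y). x \<in> feasible_set \<xi> \<and> y v* lp_A \<xi> \<ge> lp_p \<xi> \<and>
     (y v* lp_A \<xi> - lp_p \<xi>) \<bullet> x = 0}"

text \<open>Slackness turns \<open>lp_p \<xi> \<bullet> x\<close> into
  \<open>(y v* lp_A \<xi>) \<bullet> x\<close>, and moving the matrix onto \<open>x\<close> produces
  \<open>lp_b \<xi>\<close>: the duality gap is zero.\<close>

lemma complementary_pair_value:
  assumes "(x, y) \<in> complementary_pairs \<xi>"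
  shows "lp_p \<xi> \<bullet> x = y \<bullet> lp_b \<xi>"
  using assms
  by (auto simp: complementary_pairs_def feasible_set_def inner_diff_left dot_lmul_matrix)

lemma weak_duality:
  assumes "x \<in> feasible_set \<xi>" "lp_p \<xi> \<le> y v* lp_A \<xi>"
  shows "lp_p \<xi> \<bullet> x \<le> y \<bullet> lp_b \<xi>"
  using assms inner_mono_nonneg[of "lp_p \<xi>" "y v* lp_A \<xi>" x]
  by (simp add: feasible_set_def dot_lmul_matrix)

text \<open>The dual vector \<open>y\<close> certifies optimality: weak duality bounds the objective
  at every feasible point by \<open>y \<bullet> lp_b \<xi>\<close>, which \<open>x\<close>
  attains.\<close>

lemma optimal_value_complementary_pair:
  assumes "(x, y) \<in> complementary_pairs \<xi>"
  shows "optimal_value \<xi> = lp_p \<xi> \<bullet> x"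
proof (rule optimal_value_eq)
  show "x \<in> solution_set \<xi>"
    using assms weak_duality[of _ \<xi> y] complementary_pair_value[OF assms]
    by (auto simp: solution_set_def complementary_pairs_def)
qed

lemma optimal_value_diff_le:
  assumes "(x, y) \<in> complementary_pairs \<xi>" "(x', y') \<in> complementary_pairs \<xi>'"
    and x': "norm x' \<le> B" and y: "norm y \<le> B"
  shows "optimal_value \<xi>' - optimal_value \<xi> \<le> (2 * B + B\<^sup>2) * dist \<xi> \<xi>'"
proof -
  let ?d = "dist \<xi> \<xi>'"
  have B: "0 \<le> B"
    using norm_ge_zero[of y] y by linarith
  have p: "norm (lp_p \<xi>' - lp_p \<xi>) \<le> ?d"
    using dist_fst_le[of \<xi> \<xi>'] by (simp add: lp_p_def dist_norm norm_minus_commute)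
  have A: "norm (lp_A \<xi> - lp_A \<xi>') \<le> ?d"
    using dist_fst_le[of "snd \<xi>" "snd \<xi>'"] dist_snd_le[of \<xi> \<xi>']
    by (simp add: lp_A_def dist_norm)
  have b: "norm (lp_b \<xi>' - lp_b \<xi>) \<le> ?d"
    using dist_snd_le[of "snd \<xi>" "snd \<xi>'"] dist_snd_le[of \<xi> \<xi>']
    by (simp add: lp_b_def dist_norm norm_minus_commute)
  have b': "lp_A \<xi>' *v x' = lp_b \<xi>'" and "0 \<le> x'" and "lp_p \<xi> \<le> y v* lp_A \<xi>"
    using assms(1,2) by (auto simp: complementary_pairs_def feasible_set_def)
  \<comment> \<open>The point \<open>x'\<close> need not be feasible for \<open>\<xi>\<close>, so
    only its sign is used and \<open>lp_A \<xi> *v x'\<close> cannot be replaced by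
    \<open>lp_b \<xi>\<close>.\<close>
  then have "lp_p \<xi> \<bullet> x' \<le> y \<bullet> (lp_A \<xi> *v x')"
    by (metis inner_mono_nonneg dot_lmul_matrix)
  \<comment> \<open>The first value is taken in primal form at \<open>x'\<close>, the second in dual
    form at \<open>y\<close>; adding and subtracting \<open>lp_p \<xi> \<bullet> x'\<close> and
    \<open>y \<bullet> lp_b \<xi>'\<close> gives the three terms.\<close>
  then have "optimal_value \<xi>' - optimal_value \<xi>
      \<le> y \<bullet> (lp_b \<xi>' - lp_b \<xi>) + y \<bullet> ((lp_A \<xi> - lp_A \<xi>') *v x') + (lp_p \<xi>' - lp_p \<xi>) \<bullet> x'"
    using complementary_pair_value[OF assms(1)] b'
    by (simp add: optimal_value_complementary_pair[OF assms(1)]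
        optimal_value_complementary_pair[OF assms(2)]
        inner_diff_left inner_diff_right matrix_vector_mult_diff_rdistrib)
  also have "\<dots> \<le> B * ?d + B * (?d * B) + ?d * B"
  proof (intro add_mono)
    show "y \<bullet> (lp_b \<xi>' - lp_b \<xi>) \<le> B * ?d"
      by (rule order_trans[OF norm_cauchy_schwarz]) (use y b B in \<open>intro mult_mono; simp\<close>)
    have "norm ((lp_A \<xi> - lp_A \<xi>') *v x') \<le> ?d * B"
      by (rule order_trans[OF norm_matrix_vector_mult_le]) (use A x' B in \<open>intro mult_mono; simp\<close>)
    then show "y \<bullet> ((lp_A \<xi> - lp_A \<xi>') *v x') \<le> B * (?d * B)"
      by (intro order_trans[OF norm_cauchy_schwarz]) (use y B in \<open>intro mult_mono; simp\<close>)
    show "(lp_p \<xi>' - lp_p \<xi>) \<bullet> x' \<le> ?d * B"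
      by (rule order_trans[OF norm_cauchy_schwarz]) (use x' p B in \<open>intro mult_mono; simp\<close>)
  qed
  also have "\<dots> = (2 * B + B\<^sup>2) * ?d"
    by (simp add: algebra_simps power2_eq_square)
  finally show ?thesis .
qed

theorem proposition5:
  fixes \<X> :: "('m::finite, 'n::finite) lp set"
  assumes "lp_domain \<X>"
    and "weakly_solution_wise_bounded \<X>"
  shows "continuous_on \<X> optimal_value"
proof -
  obtain \<Gamma> :: "((real ^ 'n) \<times> (real ^ 'm)) set" where "bounded \<Gamma>"
    and \<Gamma>: "\<And>\<xi>. \<xi> \<in> \<X> \<Longrightarrow> \<Gamma> \<inter> complementary_pairs \<xi> \<noteq> {}"
    using assms(2) unfolding weakly_solution_wise_bounded_def complementary_pairs_def by blast
  then obtain B where "0 < B" and B: "\<And>z. z \<in> \<Gamma> \<Longrightarrow> norm z \<le> B"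
    by (auto simp: bounded_pos)
  have pair: "\<exists>x y. (x, y) \<in> complementary_pairs \<xi> \<and> norm x \<le> B \<and> norm y \<le> B"
    if \<xi>: "\<xi> \<in> \<X>" for \<xi>
  proof -
    obtain x y where "(x, y) \<in> \<Gamma>" "(x, y) \<in> complementary_pairs \<xi>"
      using \<Gamma>[OF \<xi>] by auto
    then show ?thesis
      using B[of "(x, y)"] norm_fst_le[of x y] norm_snd_le[of y x] by force
  qed
  have le: "optimal_value \<xi>' - optimal_value \<xi> \<le> (2 * B + B\<^sup>2) * dist \<xi> \<xi>'"
    if "\<xi> \<in> \<X>" "\<xi>' \<in> \<X>" for \<xi> \<xi>'
    using pair[OF that(1)] pair[OF that(2)] optimal_value_diff_le by blast
  have "(2 * B + B\<^sup>2)-lipschitz_on \<X> optimal_value"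
  proof (rule lipschitz_onI)
    fix \<xi> \<xi>' assume "\<xi> \<in> \<X>" "\<xi>' \<in> \<X>"
    \<comment> \<open>The one-sided estimate holds for all ordered pairs, so swapping the two
      problems bounds the absolute value.\<close>
    then show "dist (optimal_value \<xi>) (optimal_value \<xi>') \<le> (2 * B + B\<^sup>2) * dist \<xi> \<xi>'"
      using le[of \<xi> \<xi>'] le[of \<xi>' \<xi>] by (simp add: dist_real_def abs_le_iff dist_commute)
  qed (use \<open>0 < B\<close> in simp)
  then show ?thesis
    by (rule lipschitz_on_continuous_on)
qed

end
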